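(* Let $\mathcal{X}$ and $\mathcal{U}$ be nonempty compact sets and let $f:\mathcal{X}\times\mathcal{U}\to\mathbb{R}$ be a bounded function that is upper semicontinuous in its first argument and lower semicontinuous in its second argument. Suppose that $\mathcal{U}$ is a convex set and that $\theta\mapsto f(x,\theta)$ is a convex function on $\mathcal{U}$ for every $x\in\mathcal{X}$. Then the value of human expertise $\Delta$ satisfies $$\Delta=\min_{\theta\in\mathcal{U}}\max_{x\in\mathcal{X}}f(x,\theta)-\max_{x\in\mathcal{X}}\min_{\theta\in\mathcal{U}}f(x,\theta).$$
   Context: $\mathcal{X}$ is a subset of a topological space and $\mathcal{U}$ is a subset of a real vector space equipped with a topology; both may be infinite-dimensional. Compact means every open cover has a finite subcover. Semicontinuity in an argument means semicontinuity of the function of that argument when the other argument is fixed. For $\eta\in\mathbb{R}$ the reduced uncertainty set is $\mathcal{U}_\eta:=\{\theta\in\mathcal{U}:\max_{x'\in\mathcal{X}}f(x',\theta)\le\eta\}$. Let $\underline{\eta}:=\min\{\eta\in\mathbb{R}:\mathcal{U}_\eta\neq\emptyset\}$. The value of human expertise is $$\Delta:=\max_{\eta\ge\underline{\eta}}\Big\{\max_{x\in\mathcal{X}}\min_{\theta\in\mathcal{U}_\eta}f(x,\theta)\Big\}-\min_{\eta\ge\underline{\eta}}\Big\{\max_{x\in\mathcal{X}}\min_{\theta\in\mathcal{U}_\eta}f(x,\theta)\Big\}=\max_{x\in\mathcal{X}}\min_{\theta\in\mathcal{U}_{\underline{\eta}}}f(x,\theta)-\max_{x\in\mathcal{X}}\min_{\theta\in\mathcal{U}}f(x,\theta).$$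 Under the stated assumptions all maxima and minima are attained. *)

theory Defs
  imports "HOL-Analysis.Analysis"
begin

definition usc_on :: "'a::topological_space set \<Rightarrow> ('a \<Rightarrow> real) \<Rightarrow> bool" where
  "usc_on S g \<longleftrightarrow> (\<forall>x\<in>S. \<forall>c. g x < c \<longrightarrow> eventually (\<lambda>y. g y < c) (at x within S))"

definition lsc_on :: "'a::topological_space set \<Rightarrow> ('a \<Rightarrow> real) \<Rightarrow> bool" where
  "lsc_on S g \<longleftrightarrow> (\<forall>x\<in>S. \<forall>c. c < g x \<longrightarrow> eventually (\<lambda>y. c < g y) (at x within S))"

text \<open>Genuine maxima and minima, not suprema and infima: the values below are
  determined only if the extremum is attained.\<close>

definition max_over :: "'a set \<Rightarrow> ('a \<Rightarrow> real) \<Rightarrow> real" where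
  "max_over S g = (GREATEST m. m \<in> g ` S)"

definition min_over :: "'a set \<Rightarrow> ('a \<Rightarrow> real) \<Rightarrow> real" where
  "min_over S g = (LEAST m. m \<in> g ` S)"

definition reduced_set :: "'a set \<Rightarrow> 'b set \<Rightarrow> ('a \<Rightarrow> 'b \<Rightarrow> real) \<Rightarrow> real \<Rightarrow> 'b set" where
  "reduced_set X U f \<eta> = {\<theta> \<in> U. max_over X (\<lambda>x'. f x' \<theta>) \<le> \<eta>}"

definition eta_min :: "'a set \<Rightarrow> 'b set \<Rightarrow> ('a \<Rightarrow> 'b \<Rightarrow> real) \<Rightarrow> real" where
  "eta_min X U f = (LEAST \<eta>. reduced_set X U f \<eta> \<noteq> {})"

definition robust_value :: "'a set \<Rightarrow> 'b set \<Rightarrow> ('a \<Rightarrow> 'b \<Rightarrow> real) \<Rightarrow> real \<Rightarrow> real" where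
  "robust_value X U f \<eta> = max_over X (\<lambda>x. min_over (reduced_set X U f \<eta>) (\<lambda>\<theta>. f x \<theta>))"

definition value_of_expertise :: "'a set \<Rightarrow> 'b set \<Rightarrow> ('a \<Rightarrow> 'b \<Rightarrow> real) \<Rightarrow> real" where
  "value_of_expertise X U f =
     max_over {eta_min X U f..} (robust_value X U f) - min_over {eta_min X U f..} (robust_value X U f)"

end

theory Submission
  imports Defs
begin

text \<open>Write $g(\theta) = \max_x f(x,\theta)$ and $\underline\eta = \min_U g$. The robust value is
  antitone in $\eta$, and it equals $\max_x \min_U f$ once $\eta \ge \sup g$, so only its value at
  $\underline\eta$ needs an argument. If that value were below $\underline\eta$, every $x$ would have
  a minimiser $\theta$ of $g$ with $f(x,\theta) < \underline\eta$; by compactness of $X$ finitely many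
  such $\theta$ serve all $x$, and convexity makes their average $\bar\theta$ satisfy
  $g(\bar\theta) < \underline\eta$.\<close>

section \<open>Attained extrema of semicontinuous functions\<close>

text \<open>Unions and finite subcovers work with relatively open strict level sets, so the
  pointwise definition is traded for them.\<close>

lemma usc_on_iff_openin:
  "usc_on S g \<longleftrightarrow> (\<forall>c. openin (top_of_set S) {x \<in> S. g x < c})"
proof
  assume usc: "usc_on S g"
  show "\<forall>c. openin (top_of_set S) {x \<in> S. g x < c}"
  proof
    fix c
    show "openin (top_of_set S) {x \<in> S. g x < c}"
    proof (subst openin_subopen, intro ballI)
      fix x assume x: "x \<in> {x \<in> S. g x < c}"
      then have "eventually (\<lambda>y. g y < c) (at x within S)"
        using usc by (auto simp: usc_on_def)
      \<comment> \<open>The filter says nothing at \<open>x\<close> itself; there the inequality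
        comes from the choice of \<open>x\<close>.\<close>
      then obtain T where "open T" "x \<in> T" "\<And>y. y \<in> T \<Longrightarrow> y \<noteq> x \<Longrightarrow> y \<in> S \<Longrightarrow> g y < c"
        by (auto simp: eventually_at_topological)
      then show "\<exists>T. openin (top_of_set S) T \<and> x \<in> T \<and> T \<subseteq> {x \<in> S. g x < c}"
        using x by (intro exI[of _ "S \<inter> T"]) (auto simp: openin_open)
    qed
  qed
next
  assume op: "\<forall>c. openin (top_of_set S) {x \<in> S. g x < c}"
  show "usc_on S g"
    unfolding usc_on_def
  proof (intro ballI allI impI)
    fix x c assume x: "x \<in> S" "g x < c"
    obtain T where "open T" and T: "{x \<in> S. g x < c} = S \<inter> T"
      using op by (meson openin_open)
    moreover have "x \<in> T"
      using x T by auto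
    ultimately show "eventually (\<lambda>y. g y < c) (at x within S)"
      unfolding eventually_at_topological by (intro exI[of _ T]) auto
  qed
qed

text \<open>Negation carries the facts about upper semicontinuity and maxima over to lower
  semicontinuity and minima.\<close>

lemma lsc_on_iff_usc_on_uminus: "lsc_on S g \<longleftrightarrow> usc_on S (\<lambda>x. - g x)"
proof
  assume lsc: "lsc_on S g"
  show "usc_on S (\<lambda>x. - g x)"
    unfolding usc_on_def
  proof (intro ballI allI impI)
    fix x c assume "x \<in> S" "- g x < c"
    then have "eventually (\<lambda>y. - c < g y) (at x within S)"
      using lsc by (simp add: lsc_on_def)
    then show "eventually (\<lambda>y. - g y < c) (at x within S)"
      by (rule eventually_mono) simp
  qed
next
  assume usc: "usc_on S (\<lambda>x. - g x)"
  show "lsc_on S g"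
    unfolding lsc_on_def
  proof (intro ballI allI impI)
    fix x c assume "x \<in> S" "c < g x"
    then have "eventually (\<lambda>y. - g y < - c) (at x within S)"
      using usc[unfolded usc_on_def, rule_format, of x "- c"] by simp
    then show "eventually (\<lambda>y. c < g y) (at x within S)"
      by (rule eventually_mono) simp
  qed
qed

lemma lsc_on_iff_openin:
  "lsc_on S g \<longleftrightarrow> (\<forall>c. openin (top_of_set S) {x \<in> S. c < g x})"
proof -
  have "{x \<in> S. - g x < c} = {x \<in> S. - c < g x}" for c
    by auto
  then show ?thesis
    unfolding lsc_on_iff_usc_on_uminus usc_on_iff_openin by (metis minus_minus)
qed

text \<open>Compactness for an indexed relatively open cover. Returning indices instead of sets lets
  points label the cover and be recovered as a finite set.\<close>

lemma compact_openin_image: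
  assumes "compact S" and op: "\<And>i. i \<in> I \<Longrightarrow> openin (top_of_set S) (A i)"
    and cov: "\<And>x. x \<in> S \<Longrightarrow> \<exists>i\<in>I. x \<in> A i"
  obtains F where "F \<subseteq> I" "finite F" "\<And>x. x \<in> S \<Longrightarrow> \<exists>i\<in>F. x \<in> A i"
proof -
  have "S \<subseteq> \<Union>(A ` I)"
    using cov by blast
  then have "\<exists>D\<subseteq>A ` I. finite D \<and> S \<subseteq> \<Union>D"
    using op by (intro assms(1)[unfolded compact_eq_openin_cover, rule_format]) auto
  then obtain F where "F \<subseteq> I" "finite F" "S \<subseteq> \<Union>(A ` F)"
    by (metis finite_subset_image)
  then show ?thesis
    by (intro that[of F]) auto
qed

text \<open>Without a maximiser the sets \<open>{x \<in> S. g x < g y}\<close> cover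
  \<open>S\<close>. In a finite subcover, the label with the largest value of \<open>g\<close> lies
  in none of the chosen sets.\<close>

lemma usc_on_attains_max:
  assumes "compact S" "S \<noteq> {}" "usc_on S g"
  obtains x where "x \<in> S" "\<And>y. y \<in> S \<Longrightarrow> g y \<le> g x"
proof -
  have "\<exists>x\<in>S. \<forall>y\<in>S. g y \<le> g x"
  proof (rule ccontr)
    assume "\<not> ?thesis"
    then have cov: "\<exists>y\<in>S. x \<in> {x \<in> S. g x < g y}" if "x \<in> S" for x
      using that by (auto simp: not_le)
    obtain F where F: "F \<subseteq> S" "finite F" "\<And>x. x \<in> S \<Longrightarrow> \<exists>y\<in>F. x \<in> {x \<in> S. g x < g y}"
      using compact_openin_image[OF assms(1) _ cov] assms(3)[unfolded usc_on_iff_openin] by blast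
    have "F \<noteq> {}"
      using F(3) assms(2) by auto
    then have "Max (g ` F) \<in> g ` F"
      using F(2) by (intro Max_in) auto
    then obtain z where z: "z \<in> F" "g z = Max (g ` F)"
      by auto
    then obtain y where "y \<in> F" "g z < g y"
      using F(1,3) by blast
    then show False
      using z(2) F(2) by (metis Max_ge finite_imageI image_eqI not_le)
  qed
  then show ?thesis
    using that by blast
qed

lemma lsc_on_attains_min:
  assumes "compact S" "S \<noteq> {}" "lsc_on S g"
  obtains x where "x \<in> S" "\<And>y. y \<in> S \<Longrightarrow> g x \<le> g y"
proof -
  obtain x where "x \<in> S" "\<And>y. y \<in> S \<Longrightarrow> - g y \<le> - g x"
    using usc_on_attains_max[OF assms(1,2) assms(3)[unfolded lsc_on_iff_usc_on_uminus]] by blast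
  then show ?thesis
    by (intro that[of x]) auto
qed

text \<open>\<open>GREATEST\<close> is determined only when a greatest value exists, so a point
  attaining \<open>m\<close> is supplied along with the bound.\<close>

lemma max_over_eqI:
  assumes "x \<in> S" "g x = m" "\<And>y. y \<in> S \<Longrightarrow> g y \<le> m"
  shows "max_over S g = m"
  unfolding max_over_def by (rule Greatest_equality) (use assms in auto)

lemma min_over_eqI:
  assumes "x \<in> S" "g x = m" "\<And>y. y \<in> S \<Longrightarrow> m \<le> g y"
  shows "min_over S g = m"
  unfolding min_over_def by (rule Least_equality) (use assms in auto)

lemma max_over_attained:
  assumes "compact S" "S \<noteq> {}" "usc_on S g"
  obtains x where "x \<in> S" "g x = max_over S g" "\<And>y. y \<in> S \<Longrightarrow> g y \<le> max_over S g"
proof -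
  obtain x where x: "x \<in> S" "\<And>y. y \<in> S \<Longrightarrow> g y \<le> g x"
    using usc_on_attains_max[OF assms] by blast
  then have "max_over S g = g x"
    by (intro max_over_eqI[of x]) auto
  with x show ?thesis
    by (intro that[of x]) auto
qed

lemma min_over_attained:
  assumes "compact S" "S \<noteq> {}" "lsc_on S g"
  obtains x where "x \<in> S" "g x = min_over S g" "\<And>y. y \<in> S \<Longrightarrow> min_over S g \<le> g y"
proof -
  obtain x where x: "x \<in> S" "\<And>y. y \<in> S \<Longrightarrow> g x \<le> g y"
    using lsc_on_attains_min[OF assms] by blast
  then have "min_over S g = g x"
    by (intro min_over_eqI[of x]) auto
  with x show ?thesis
    by (intro that[of x]) auto
qed

lemma less_max_over_iff:
  assumes "compact S" "S \<noteq> {}" "usc_on S g"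
  shows "c < max_over S g \<longleftrightarrow> (\<exists>x\<in>S. c < g x)"
  using max_over_attained[OF assms] by (metis less_le_trans)

lemma min_over_less_iff:
  assumes "compact S" "S \<noteq> {}" "lsc_on S g"
  shows "min_over S g < c \<longleftrightarrow> (\<exists>x\<in>S. g x < c)"
  using min_over_attained[OF assms] by (metis le_less_trans)

text \<open>Since each maximum over \<open>X\<close> is attained, it exceeds \<open>c\<close>
  exactly when some \<open>f x \<theta>\<close> does. Its strict superlevel set is thus a union of
  open ones.\<close>

lemma lsc_on_max_over:
  assumes "compact X" "X \<noteq> {}"
    and usc: "\<And>\<theta>. \<theta> \<in> U \<Longrightarrow> usc_on X (\<lambda>x. f x \<theta>)"
    and lsc: "\<And>x. x \<in> X \<Longrightarrow> lsc_on U (f x)"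
  shows "lsc_on U (\<lambda>\<theta>. max_over X (\<lambda>x. f x \<theta>))"
  unfolding lsc_on_iff_openin
proof
  fix c
  have "{\<theta> \<in> U. c < max_over X (\<lambda>x. f x \<theta>)} = (\<Union>x\<in>X. {\<theta> \<in> U. c < f x \<theta>})"
    using less_max_over_iff[OF assms(1,2) usc] by auto
  then show "openin (top_of_set U) {\<theta> \<in> U. c < max_over X (\<lambda>x. f x \<theta>)}"
    using lsc by (auto simp: lsc_on_iff_openin)
qed

text \<open>The dual union argument, indexed by \<theta>. It ensures that the outer maximum in
  \<open>robust_value\<close> is attained.\<close>

lemma usc_on_min_over:
  assumes "compact V" "V \<noteq> {}"
    and usc: "\<And>\<theta>. \<theta> \<in> V \<Longrightarrow> usc_on X (\<lambda>x. f x \<theta>)"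
    and lsc: "\<And>x. x \<in> X \<Longrightarrow> lsc_on V (f x)"
  shows "usc_on X (\<lambda>x. min_over V (f x))"
  unfolding usc_on_iff_openin
proof
  fix c
  have "{x \<in> X. min_over V (f x) < c} = (\<Union>\<theta>\<in>V. {x \<in> X. f x \<theta> < c})"
    using min_over_less_iff[OF assms(1,2) lsc] by auto
  then show "openin (top_of_set X) {x \<in> X. min_over V (f x) < c}"
    using usc by (auto simp: usc_on_iff_openin)
qed

lemma lsc_on_subset: "lsc_on S g \<Longrightarrow> T \<subseteq> S \<Longrightarrow> lsc_on T g"
  unfolding lsc_on_def by (meson at_le filter_leD subset_iff)

text \<open>Sublevel sets are closed relative to the compact set \<open>S\<close>. For reduced sets
  this gives attainment of the inner minimum.\<close>

lemma compact_lsc_sublevel: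
  assumes "compact S" "lsc_on S g"
  shows "compact {x \<in> S. g x \<le> c}"
proof -
  have "{x \<in> S. g x \<le> c} = S - {x \<in> S. c < g x}"
    by auto
  then have "closedin (top_of_set S) {x \<in> S. g x \<le> c}"
    using assms(2) by (simp add: lsc_on_iff_openin closedin_diff)
  then show ?thesis
    by (rule closedin_compact[OF assms(1)])
qed

section \<open>The robust value\<close>

text \<open>Compactness of \<open>X\<close> leaves finitely many points of \<open>V\<close>, one of
  them strict at each \<open>x\<close>. By Jensen's inequality their average is strict at every
  \<open>x\<close> simultaneously; it lies in \<open>U\<close> by convexity of
  \<open>U\<close>.\<close>

lemma average_of_strict_upper_bounds:
  fixes f :: "'a::topological_space \<Rightarrow> 'b::real_vector \<Rightarrow> real"
  assumes "compact X" "X \<noteq> {}" and "convex U"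
    and usc: "\<And>\<theta>. \<theta> \<in> U \<Longrightarrow> usc_on X (\<lambda>x. f x \<theta>)"
    and conv: "\<And>x. x \<in> X \<Longrightarrow> convex_on U (f x)"
    and V: "V \<subseteq> U" "\<And>x \<theta>. x \<in> X \<Longrightarrow> \<theta> \<in> V \<Longrightarrow> f x \<theta> \<le> c"
    and less: "\<And>x. x \<in> X \<Longrightarrow> \<exists>\<theta>\<in>V. f x \<theta> < c"
  obtains \<theta> where "\<theta> \<in> U" "\<And>x. x \<in> X \<Longrightarrow> f x \<theta> < c"
proof -
  obtain F where F: "F \<subseteq> V" "finite F" "\<And>x. x \<in> X \<Longrightarrow> \<exists>\<theta>\<in>F. x \<in> {x \<in> X. f x \<theta> < c}"
    using compact_openin_image[OF assms(1), of V "\<lambda>\<theta>. {x \<in> X. f x \<theta> < c}"] usc V(1) less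
    by (auto simp: usc_on_iff_openin subset_iff)
  have ne: "F \<noteq> {}"
    using F(3) assms(2) by auto
  \<comment> \<open>Which point is strict depends on \<open>x\<close>, so every weight must be
    positive; equal weights achieve this.\<close>
  define a where "a = 1 / real (card F)"
  have a: "a > 0" "(\<Sum>\<theta>\<in>F. a) = 1"
    using ne F(2) by (auto simp: a_def card_gt_0_iff)
  have mem: "(\<Sum>\<theta>\<in>F. a *\<^sub>R \<theta>) \<in> U"
    using F V(1) a by (intro convex_sum assms(3)) auto
  have "f x (\<Sum>\<theta>\<in>F. a *\<^sub>R \<theta>) < c" if x: "x \<in> X" for x
  proof -
    have "f x (\<Sum>\<theta>\<in>F. a *\<^sub>R \<theta>) \<le> (\<Sum>\<theta>\<in>F. a * f x \<theta>)"
      using F V(1) a ne by (intro convex_on_sum[OF _ _ conv[OF x]]) auto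
    also have "\<dots> < (\<Sum>\<theta>\<in>F. a * c)"
    proof (rule sum_strict_mono_ex1[OF F(2)])
      show "\<forall>\<theta>\<in>F. a * f x \<theta> \<le> a * c"
        using V(2)[OF x] F(1) a(1) by auto
      show "\<exists>\<theta>\<in>F. a * f x \<theta> < a * c"
        using F(3)[OF x] a(1) by auto
    qed
    also have "\<dots> = c"
      unfolding sum_distrib_right[symmetric] a(2) by simp
    finally show ?thesis .
  qed
  with mem show ?thesis
    by (rule that)
qed

theorem corollary2:
  fixes X :: "'a::topological_space set"
    and U :: "'b::{real_vector, topological_space} set"
    and f :: "'a \<Rightarrow> 'b \<Rightarrow> real"
  assumes "X \<noteq> {}" and "compact X"
    and "U \<noteq> {}" and "compact U"
    and "bounded ((\<lambda>(x, \<theta>). f x \<theta>) ` (X \<times> U))"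
    and "\<And>\<theta>. \<theta> \<in> U \<Longrightarrow> usc_on X (\<lambda>x. f x \<theta>)"
    and "\<And>x. x \<in> X \<Longrightarrow> lsc_on U (\<lambda>\<theta>. f x \<theta>)"
    and "convex U"
    and "\<And>x. x \<in> X \<Longrightarrow> convex_on U (\<lambda>\<theta>. f x \<theta>)"
  shows "value_of_expertise X U f =
           min_over U (\<lambda>\<theta>. max_over X (\<lambda>x. f x \<theta>)) - max_over X (\<lambda>x. min_over U (\<lambda>\<theta>. f x \<theta>))"
proof -
  note usc = assms(6) and lsc = assms(7)
  define g where "g \<theta> = max_over X (\<lambda>x. f x \<theta>)" for \<theta>
  define \<eta>0 where "\<eta>0 = min_over U g"
  let ?V = "reduced_set X U f" and ?r = "robust_value X U f"
  have V: "?V \<eta> = {\<theta> \<in> U. g \<theta> \<le> \<eta>}" for \<eta>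
    by (simp add: reduced_set_def g_def)
  have f_le_g: "f x \<theta> \<le> g \<theta>" if "x \<in> X" "\<theta> \<in> U" for x \<theta>
    using max_over_attained[OF assms(2,1) usc[OF that(2)]] that(1) unfolding g_def by metis
  have g_attained: "\<exists>x\<in>X. f x \<theta> = g \<theta>" if "\<theta> \<in> U" for \<theta>
    using max_over_attained[OF assms(2,1) usc[OF that]] unfolding g_def by metis
  have lsc_g: "lsc_on U g"
    using lsc_on_max_over[OF assms(2,1) usc lsc] by (simp add: g_def[abs_def])
  obtain \<theta>0 where \<theta>0: "\<theta>0 \<in> U" "g \<theta>0 = \<eta>0" and \<eta>0_le: "\<And>\<theta>. \<theta> \<in> U \<Longrightarrow> \<eta>0 \<le> g \<theta>"
    using min_over_attained[OF assms(4,3) lsc_g] unfolding \<eta>0_def by metis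
  \<comment> \<open>A reduced set is nonempty exactly from the least value of \<open>g\<close>
    onwards, and \<theta>0 shows that this value itself qualifies.\<close>
  have eta_min: "eta_min X U f = \<eta>0"
    unfolding eta_min_def V using \<theta>0 \<eta>0_le by (intro Least_equality) force+
  have V_ne: "?V \<eta> \<noteq> {}" if "\<eta>0 \<le> \<eta>" for \<eta>
    using \<theta>0 that by (auto simp: V)
  have V_compact: "compact (?V \<eta>)" for \<eta>
    unfolding V by (rule compact_lsc_sublevel[OF assms(4) lsc_g])
  have V_sub: "?V \<eta> \<subseteq> U" for \<eta>
    by (auto simp: V)
  have lsc_V: "lsc_on (?V \<eta>) (f x)" if "x \<in> X" for x \<eta>
    using lsc[OF that] V_sub by (rule lsc_on_subset)
  have usc_V: "usc_on X (\<lambda>x. min_over (?V \<eta>) (f x))" if "\<eta>0 \<le> \<eta>" for \<eta>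
    using V_sub by (intro usc_on_min_over V_compact V_ne that lsc_V usc) auto
  have less_r: "c < ?r \<eta> \<longleftrightarrow> (\<exists>x\<in>X. c < min_over (?V \<eta>) (f x))" if "\<eta>0 \<le> \<eta>" for c \<eta>
    unfolding robust_value_def by (rule less_max_over_iff[OF assms(2,1) usc_V[OF that]])
  have less_min: "c < min_over (?V \<eta>) (f x) \<Longrightarrow> \<theta> \<in> ?V \<eta> \<Longrightarrow> c < f x \<theta>"
    if "\<eta>0 \<le> \<eta>" "x \<in> X" for c \<eta> x \<theta>
    using min_over_attained[OF V_compact V_ne[OF that(1)] lsc_V[OF that(2)]] by (metis less_le_trans)
  \<comment> \<open>Raising \<eta> enlarges the reduced set and so lowers each inner minimum: a
    minimiser over the smaller set is still a competitor in the larger one.\<close>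
  have antitone: "?r \<eta>' \<le> ?r \<eta>" if le: "\<eta>0 \<le> \<eta>" "\<eta> \<le> \<eta>'" for \<eta> \<eta>'
  proof (rule dense_le)
    fix c assume "c < ?r \<eta>'"
    then obtain x where x: "x \<in> X" "c < min_over (?V \<eta>') (f x)"
      using less_r[of \<eta>' c] le by auto
    obtain \<theta> where \<theta>: "\<theta> \<in> ?V \<eta>" "f x \<theta> = min_over (?V \<eta>) (f x)"
      using min_over_attained[OF V_compact V_ne[OF le(1)] lsc_V[OF x(1)]] by metis
    then have "\<theta> \<in> ?V \<eta>'"
      using le(2) by (auto simp: V)
    then have "c < min_over (?V \<eta>) (f x)"
      using less_min[of \<eta>' x c \<theta>] x le \<theta>(2) by auto
    then show "c \<le> ?r \<eta>"
      using less_r le(1) x(1) by (metis less_imp_le)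
  qed
  have r0: "?r \<eta>0 = \<eta>0"
  proof (rule antisym)
    show "?r \<eta>0 \<le> \<eta>0"
    proof (rule dense_le)
      fix c assume "c < ?r \<eta>0"
      then obtain x where x: "x \<in> X" "c < min_over (?V \<eta>0) (f x)"
        using less_r[of \<eta>0 c] by auto
      \<comment> \<open>\<theta>0 belongs to the smallest nonempty reduced set, so it bounds the
        inner minimum for every \<open>x\<close>.\<close>
      then have "c < f x \<theta>0"
        using less_min[of \<eta>0 x c \<theta>0] \<theta>0 by (auto simp: V)
      then show "c \<le> \<eta>0"
        using f_le_g[OF x(1) \<theta>0(1)] \<theta>0(2) by linarith
    qed
  next
    show "\<eta>0 \<le> ?r \<eta>0"
    proof (rule ccontr)
      assume "\<not> \<eta>0 \<le> ?r \<eta>0"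
      moreover have "min_over (?V \<eta>0) (f x) \<le> ?r \<eta>0" if "x \<in> X" for x
        using less_r[of \<eta>0 "?r \<eta>0"] that by (auto simp: not_less)
      ultimately have "min_over (?V \<eta>0) (f x) < \<eta>0" if "x \<in> X" for x
        using that by force
      then have less: "\<exists>\<theta>\<in>?V \<eta>0. f x \<theta> < \<eta>0" if "x \<in> X" for x
        using min_over_less_iff[OF V_compact V_ne[OF order_refl] lsc_V] that by blast
      have le: "f x \<theta> \<le> \<eta>0" if "x \<in> X" "\<theta> \<in> ?V \<eta>0" for x \<theta>
        using f_le_g[of x \<theta>] that by (auto simp: V)
      \<comment> \<open>The averaging lemma is applied with \<open>V = ?V \<eta>0\<close> and
        \<open>c = \<eta>0\<close>. At a point of \<open>X\<close> where \<open>g \<theta>\<close>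
        is attained, the outcome contradicts minimality of \<eta>0.\<close>
      obtain \<theta> where "\<theta> \<in> U" "\<And>x. x \<in> X \<Longrightarrow> f x \<theta> < \<eta>0"
        using average_of_strict_upper_bounds[OF assms(2,1,8) usc assms(9) V_sub le less] by blast
      then show False
        using g_attained \<eta>0_le by (metis not_le)
    qed
  qed
  \<comment> \<open>Boundedness of \<open>f\<close> yields a threshold beyond which the constraint
    on \<theta> is vacuous and the reduced set is all of \<open>U\<close>.\<close>
  obtain b where b: "\<And>x \<theta>. x \<in> X \<Longrightarrow> \<theta> \<in> U \<Longrightarrow> \<bar>f x \<theta>\<bar> \<le> b"
    using assms(5) by (force simp: bounded_iff)
  have "g \<theta> \<le> b" if "\<theta> \<in> U" for \<theta>
    using g_attained[OF that] b that by (metis abs_le_D1)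
  then have V_large: "?V \<eta> = U" if "b \<le> \<eta>" for \<eta>
    using that unfolding V by force
  \<comment> \<open>The maximum with \<eta>0 places \<eta>1 in the admissible range by
    construction.\<close>
  define \<eta>1 where "\<eta>1 = max \<eta>0 b"
  have r1: "?r \<eta>1 = max_over X (\<lambda>x. min_over U (f x))"
    using V_large[of \<eta>1] by (simp add: robust_value_def \<eta>1_def)
  \<comment> \<open>Up to \<eta>1 antitonicity applies; beyond it the reduced set, and with it the
    robust value, is constant.\<close>
  have min_r: "?r \<eta>1 \<le> ?r \<eta>" if "\<eta>0 \<le> \<eta>" for \<eta>
  proof (cases "\<eta> \<le> \<eta>1")
    case True
    then show ?thesis using antitone that by blast
  next
    case False
    then have "?V \<eta> = ?V \<eta>1"
      using V_large by (simp add: \<eta>1_def)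
    then show ?thesis by (simp add: robust_value_def)
  qed
  \<comment> \<open>The two extrema over \<eta> are attained at \<eta>0 and \<eta>1, giving the
    minimax and the maximin value respectively.\<close>
  have "max_over {\<eta>0..} ?r = \<eta>0"
    using r0 antitone[of \<eta>0] by (intro max_over_eqI[of \<eta>0]) auto
  moreover have "min_over {\<eta>0..} ?r = ?r \<eta>1"
    using min_r by (intro min_over_eqI[of \<eta>1]) (auto simp: \<eta>1_def)
  ultimately show ?thesis
    by (simp add: value_of_expertise_def eta_min r1 \<eta>0_def g_def[abs_def])
qed

end
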